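(* Let $\mathcal D\subset\mathbb R^d$, $d\ge1$, be a bounded convex open set, let $\lambda_1^{\mathcal D}$ be the principal Dirichlet eigenvalue of the Laplacian $-\Delta$ in $\mathcal D$, let $x^*\in\mathcal D$ be a point where the corresponding (positive) principal Dirichlet eigenfunction attains its global maximum, and let $\mathscr B$ be the unit ball of $\mathbb R^d$ centered at the origin, with principal Dirichlet eigenvalue $\lambda_1^{\mathscr B}$. Then $$\operatorname{dist}(x^*,\partial\mathcal D)\ \ge\ \sqrt{\frac{\theta}{\lambda_1^{\mathscr B}}}\ \operatorname{inrad}\mathcal D ,$$ where $$\theta=-\min_{\kappa>1}\frac1\kappa\log\big(1-F(-1)(1-e^{1-\kappa})\big)\approx0.0833$$ and $F$ is the distribution function of a Gaussian random variable with mean $0$ and variance $2$.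
   Context: $\operatorname{inrad}\mathcal D$ denotes the inradius of $\mathcal D$, i.e. the supremum of radii of balls contained in $\mathcal D$. *)

theory Defs
  imports "HOL-Probability.Probability"
begin

definition C1_on :: "'a::euclidean_space set \<Rightarrow> ('a \<Rightarrow> real) \<Rightarrow> bool" where
  "C1_on S u \<longleftrightarrow> u differentiable_on S \<and>
     (\<forall>b\<in>Basis. continuous_on S (\<lambda>x. frechet_derivative u (at x) b))"

definition C2_on :: "'a::euclidean_space set \<Rightarrow> ('a \<Rightarrow> real) \<Rightarrow> bool" where
  "C2_on S u \<longleftrightarrow> C1_on S u \<and> (\<forall>b\<in>Basis. C1_on S (\<lambda>x. frechet_derivative u (at x) b))"

definition laplacian :: "('a::euclidean_space \<Rightarrow> real) \<Rightarrow> 'a \<Rightarrow> real" where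
  "laplacian u x =
     (\<Sum>b\<in>Basis. frechet_derivative (\<lambda>y. frechet_derivative u (at y) b) (at x) b)"

text \<open>
  Classical Dirichlet eigenfunctions: twice continuously differentiable in the open set \<open>D\<close> and
  continuous up to the boundary, where they vanish. On a bounded convex open set every boundary
  point is regular, so these are exactly the eigenfunctions of the Dirichlet Laplacian in
  \<open>L\<^sup>2(D)\<close> (each taken in its continuous version). Values outside \<open>closure D\<close> play no role.
\<close>

definition dirichlet_eigenfunction ::
  "'a::euclidean_space set \<Rightarrow> real \<Rightarrow> ('a \<Rightarrow> real) \<Rightarrow> bool" where
  "dirichlet_eigenfunction D lam u \<longleftrightarrow>
     C2_on D u \<and> continuous_on (closure D) u \<and>
     (\<forall>x\<in>D. - laplacian u x = lam * u x) \<and>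
     (\<forall>x\<in>frontier D. u x = 0) \<and>
     (\<exists>x\<in>D. u x \<noteq> 0)"

definition dirichlet_eigenvalue :: "'a::euclidean_space set \<Rightarrow> real \<Rightarrow> bool" where
  "dirichlet_eigenvalue D lam \<longleftrightarrow> (\<exists>u. dirichlet_eigenfunction D lam u)"

definition principal_dirichlet_eigenvalue :: "'a::euclidean_space set \<Rightarrow> real \<Rightarrow> bool" where
  "principal_dirichlet_eigenvalue D lam \<longleftrightarrow>
     dirichlet_eigenvalue D lam \<and> (\<forall>\<mu>. dirichlet_eigenvalue D \<mu> \<longrightarrow> lam \<le> \<mu>)"

definition inrad :: "'a::euclidean_space set \<Rightarrow> real" where
  "inrad D = Sup {r. 0 < r \<and> (\<exists>x. ball x r \<subseteq> D)}"

text \<open>The second parameter of \<^const>\<open>normal_density\<close> is the standard deviation.\<close>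

definition gauss2_cdf :: "real \<Rightarrow> real" where
  "gauss2_cdf = cdf (density lborel (normal_density 0 (sqrt 2)))"

text \<open>\<open>LEAST\<close> renders a genuine minimum: its value is determined only if the minimum is attained.\<close>

definition theta :: real where
  "theta = - (LEAST m. m \<in>
     (\<lambda>\<kappa>. 1 / \<kappa> * ln (1 - gauss2_cdf (-1) * (1 - exp (1 - \<kappa>)))) ` {1<..})"

end

theory Submission
  imports Defs
begin

text \<open>
  Write \<open>\<lambda>\<close> for the principal eigenvalue of \<open>D\<close> and \<open>r\<close> for the distance of the maximum point to
  the boundary. The domain lies in a half-space whose bounding hyperplane is at distance at most
  \<open>r\<close> from the maximum point; comparing \<open>u\<close> in a slab of width \<open>a > r\<close> at that hyperplane with a
  parabola of height \<open>max u\<close> shows \<open>\<lambda> r\<^sup>2 \<ge> 2\<close>, without any probability. On the other hand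
  \<open>\<lambda> \<rho>\<^sup>2 \<le> \<lambda>\<^sub>B\<close> for every closed ball of radius \<open>\<rho>\<close> in \<open>D\<close>: divide a rescaled eigenfunction of the
  unit ball by the positive function \<open>u\<close> and look at the maximum of the quotient. Both comparisons
  only use the second derivative test. Since \<open>\<theta> < 2\<close>, which needs only numerical bounds for the
  Gaussian distribution function and for the objective near its minimiser \<open>\<kappa> \<approx> 9/4\<close>, the claim
  follows.
\<close>

section \<open>Eigenvalue bounds by comparison\<close>

lemma second_derivative_nonpos_at_max:
  fixes f :: "real \<Rightarrow> real"
  assumes "0 < e" and f': "\<And>t. \<bar>t\<bar> < e \<Longrightarrow> (f has_real_derivative f' t) (at t)"
    and f'': "(f' has_real_derivative c) (at 0)"
    and max: "\<And>t. \<bar>t\<bar> < e \<Longrightarrow> f t \<le> f 0"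
  shows "c \<le> 0"
proof (rule ccontr)
  assume "\<not> c \<le> 0"
  then obtain d where d: "0 < d" "\<And>h. 0 < h \<Longrightarrow> h < d \<Longrightarrow> f' 0 < f' h"
    using DERIV_pos_inc_right[OF f''] by auto
  have f'0: "f' 0 = 0"
    by (rule DERIV_local_max[OF f'[of 0] \<open>0 < e\<close>]) (use max \<open>0 < e\<close> in auto)
  define h where "h = min d e / 2"
  have h: "0 < h" "h < d" "h < e" using d \<open>0 < e\<close> by (auto simp: h_def)
  obtain z where "0 < z" "z < h" "f h - f 0 = (h - 0) * f' z"
    using MVT2[OF h(1), of f f'] f' h by force
  then have "0 < f h - f 0" using d(2)[of z] f'0 h by simp
  then show False using max[of h] h by simp
qed

text \<open>Each summand is a one-variable second derivative along the coordinate line through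
  \<open>p\<close>. Keeping \<open>G\<close> and \<open>H\<close> abstract lets the test apply to
  combinations of functions whose derivatives are known termwise.\<close>

lemma sum_second_derivatives_nonpos_at_max:
  fixes g :: "'a::euclidean_space \<Rightarrow> real"
  assumes S: "open S" and p: "p \<in> S"
    and g1: "\<And>x. x \<in> S \<Longrightarrow> (g has_derivative G x) (at x)"
    and g2: "\<And>b. b \<in> Basis \<Longrightarrow> ((\<lambda>x. G x b) has_derivative H b) (at p)"
    and max: "\<And>x. x \<in> S \<Longrightarrow> g x \<le> g p"
  shows "(\<Sum>b\<in>Basis. H b b) \<le> 0"
proof (rule sum_nonpos)
  fix b :: 'a assume b: "b \<in> Basis"
  obtain e where e: "0 < e" "ball p e \<subseteq> S" using S p open_contains_ball by blast
  have line: "p + t *\<^sub>R b \<in> S" if "\<bar>t\<bar> < e" for t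
    using e that b by (auto simp: subset_iff dist_norm)
  have lin: "((\<lambda>t. p + t *\<^sub>R b) has_derivative (\<lambda>h. h *\<^sub>R b)) (at t)" for t
    by (auto intro!: derivative_eq_intros)
  show "H b b \<le> 0"
  proof (rule second_derivative_nonpos_at_max[OF e(1)])
    show "g (p + t *\<^sub>R b) \<le> g (p + 0 *\<^sub>R b)" if "\<bar>t\<bar> < e" for t
      using max[OF line[OF that]] by simp
    show "((\<lambda>t. g (p + t *\<^sub>R b)) has_real_derivative G (p + t *\<^sub>R b) b) (at t)" if "\<bar>t\<bar> < e" for t
      using has_derivative_compose[OF lin g1[OF line[OF that]]]
        linear_scale[OF has_derivative_linear[OF g1[OF line[OF that]]]]
      unfolding has_field_derivative_def by (auto elim!: has_derivative_eq_rhs simp: mult.commute)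
    have "((\<lambda>x. G x b) has_derivative H b) (at (p + 0 *\<^sub>R b))"
      using g2[OF b] by simp
    from has_derivative_compose[OF lin this]
    show "((\<lambda>t. G (p + t *\<^sub>R b) b) has_real_derivative H b b) (at 0)"
      using linear_scale[OF has_derivative_linear[OF g2[OF b]]]
      unfolding has_field_derivative_def by (auto elim!: has_derivative_eq_rhs simp: mult.commute)
  qed
qed

lemma C2_on_has_derivative:
  assumes "C2_on S u" "open S" "x \<in> S"
  shows "(u has_derivative frechet_derivative u (at x)) (at x)"
    and "b \<in> Basis \<Longrightarrow> ((\<lambda>y. frechet_derivative u (at y) b) has_derivative
           frechet_derivative (\<lambda>y. frechet_derivative u (at y) b) (at x)) (at x)"
proof -
  have "u differentiable at x"
    using assms by (auto simp: C2_on_def C1_on_def differentiable_on_eq_differentiable_at)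
  then show "(u has_derivative frechet_derivative u (at x)) (at x)"
    by (simp add: frechet_derivative_works)
  assume "b \<in> Basis"
  then have "(\<lambda>y. frechet_derivative u (at y) b) differentiable at x"
    using assms by (auto simp: C2_on_def C1_on_def differentiable_on_eq_differentiable_at)
  then show "((\<lambda>y. frechet_derivative u (at y) b) has_derivative
           frechet_derivative (\<lambda>y. frechet_derivative u (at y) b) (at x)) (at x)"
    by (simp add: frechet_derivative_works)
qed

lemma frechet_derivative_scaleR:
  assumes "(f has_derivative frechet_derivative f F) F"
  shows "frechet_derivative f F (r *\<^sub>R h) = r *\<^sub>R frechet_derivative f F h"
  using linear_scale[OF has_derivative_linear[OF assms]] by simp

section \<open>Comparison with a rescaled unit ball\<close>

text \<open>Let \<open>M\<close> be the maximum of the quotient of \<open>s * v\<close> by the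
  rescaled \<open>u\<close>. Then \<open>s * v - M * ?U\<close> is at most 0 and vanishes at the
  maximum point \<open>p\<close>, so its Laplacian there is nonpositive; inserting both eigenvalue
  equations and cancelling \<open>M * ?U p > 0\<close> gives the claim. The closed ball keeps
  \<open>u\<close> positive up to the sphere, so the quotient is continuous on a compact
  set.\<close>

lemma eigenvalue_le_of_positive_eigenfunction:
  fixes u v :: "'a::euclidean_space \<Rightarrow> real"
  assumes D: "open D" and u: "dirichlet_eigenfunction D lam u" and pos: "\<And>x. x \<in> D \<Longrightarrow> 0 < u x"
    and v: "dirichlet_eigenfunction (ball 0 1) mu v"
    and \<rho>: "0 < \<rho>" and sub: "cball x0 \<rho> \<subseteq> D"
  shows "lam * \<rho>\<^sup>2 \<le> mu"
proof -
  let ?U = "\<lambda>x. u (x0 + \<rho> *\<^sub>R x)"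
  have inD: "x0 + \<rho> *\<^sub>R x \<in> D" if "x \<in> cball 0 1" for x
    using sub \<rho> that by (auto simp: subset_iff dist_norm mult_left_le)
  have u2: "C2_on D u" and ueq: "\<And>x. x \<in> D \<Longrightarrow> - laplacian u x = lam * u x"
    using u by (auto simp: dirichlet_eigenfunction_def)
  have v2: "C2_on (ball 0 1) v" and veq: "\<And>x. x \<in> ball 0 1 \<Longrightarrow> - laplacian v x = mu * v x"
    and v0: "\<And>x. x \<in> sphere 0 1 \<Longrightarrow> v x = 0" and vc: "continuous_on (cball 0 1) v"
    using v by (auto simp: dirichlet_eigenfunction_def)
  obtain y where y: "y \<in> ball 0 1" "v y \<noteq> 0"
    using v unfolding dirichlet_eigenfunction_def by blast
  \<comment> \<open>No sign of \<open>v\<close> is assumed; this factor makes \<open>s * v\<close>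
    positive somewhere, hence \<open>M > 0\<close>.\<close>
  define s where "s = sgn (v y)"
  have s: "0 < s * v y" using y by (simp add: s_def sgn_if)
  let ?q = "\<lambda>x. s * v x / ?U x"
  have "continuous_on D u"
    using C2_on_has_derivative(1)[OF u2 D]
    by (auto intro!: continuous_at_imp_continuous_on intro: has_derivative_continuous)
  moreover have "continuous_on (cball 0 1) (\<lambda>x :: 'a. x0 + \<rho> *\<^sub>R x)"
    by (intro continuous_on_add continuous_on_scaleR continuous_on_const continuous_on_id)
  ultimately have "continuous_on (cball 0 1) ?U"
    by (rule continuous_on_compose2[of D u]) (use inD in blast)
  moreover have "\<forall>x\<in>cball 0 1. ?U x \<noteq> 0"
    using pos[OF inD] by (metis less_irrefl)
  ultimately have "continuous_on (cball 0 1) ?q"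
    using vc by (intro continuous_on_divide continuous_on_mult continuous_on_const)
  then obtain p where p: "p \<in> cball 0 1" "\<And>x. x \<in> cball 0 1 \<Longrightarrow> ?q x \<le> ?q p"
    using continuous_attains_sup[of "cball 0 1" ?q] by auto
  define M where "M = ?q p"
  have "0 < ?q y" using s pos[OF inD[of y]] y by auto
  then have M: "0 < M" using p(2)[of y] y by (force simp: M_def)
  then have "v p \<noteq> 0" by (auto simp: M_def)
  \<comment> \<open>A positive maximum cannot lie on the sphere, where \<open>v\<close>
    vanishes.\<close>
  then have pb: "p \<in> ball 0 1" using v0[of p] p(1) by (force simp: less_le)
  have Up: "0 < ?U p" using pos inD p(1) by blast
  have vp: "s * v p = M * ?U p" using Up by (simp add: M_def)
  have le: "s * v x - M * ?U x \<le> 0" if "x \<in> ball 0 1" for x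
    using p(2)[of x] pos[OF inD[of x]] that by (auto simp: M_def[symmetric] field_simps)
  have aff: "((\<lambda>x. x0 + \<rho> *\<^sub>R x) has_derivative (\<lambda>h. \<rho> *\<^sub>R h)) (at x)" for x :: 'a
    by (auto intro!: derivative_eq_intros)
  \<comment> \<open>The test is applied to the difference touching 0 from below, which avoids
    differentiating the quotient; each derivative of the rescaled \<open>u\<close> contributes a
    factor \<open>\<rho>\<close>.\<close>
  have "(\<Sum>b\<in>Basis. s * frechet_derivative (\<lambda>y. frechet_derivative v (at y) b) (at p) b
      - M * (\<rho> * (\<rho> * frechet_derivative (\<lambda>y. frechet_derivative u (at y) b) (at (x0 + \<rho> *\<^sub>R p)) b))) \<le> 0"
  proof (rule sum_second_derivatives_nonpos_at_max[OF open_ball pb, where g = "\<lambda>x. s * v x - M * ?U x"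
        and G = "\<lambda>x h. s * frechet_derivative v (at x) h
          - M * (\<rho> * frechet_derivative u (at (x0 + \<rho> *\<^sub>R x)) h)"
        and H = "\<lambda>b h. s * frechet_derivative (\<lambda>y. frechet_derivative v (at y) b) (at p) h
          - M * (\<rho> * (\<rho> * frechet_derivative (\<lambda>y. frechet_derivative u (at y) b) (at (x0 + \<rho> *\<^sub>R p)) h))"])
    show "s * v x - M * ?U x \<le> s * v p - M * ?U p" if "x \<in> ball 0 1" for x
      using le[OF that] vp by simp
    show "((\<lambda>x. s * v x - M * ?U x) has_derivative (\<lambda>h. s * frechet_derivative v (at x) h
          - M * (\<rho> * frechet_derivative u (at (x0 + \<rho> *\<^sub>R x)) h))) (at x)" if "x \<in> ball 0 1" for x
    proof -
      have xD: "x0 + \<rho> *\<^sub>R x \<in> D" using that by (intro inD) auto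
      note du = C2_on_has_derivative(1)[OF u2 D xD]
      from has_derivative_compose[OF aff du] show ?thesis
        unfolding frechet_derivative_scaleR[OF du] real_scaleR_def
        by (intro has_derivative_diff has_derivative_mult_right
            C2_on_has_derivative(1)[OF v2 open_ball that])
    qed
    show "((\<lambda>x. s * frechet_derivative v (at x) b - M * (\<rho> * frechet_derivative u (at (x0 + \<rho> *\<^sub>R x)) b))
      has_derivative (\<lambda>h. s * frechet_derivative (\<lambda>y. frechet_derivative v (at y) b) (at p) h
        - M * (\<rho> * (\<rho> * frechet_derivative (\<lambda>y. frechet_derivative u (at y) b) (at (x0 + \<rho> *\<^sub>R p)) h)))) (at p)"
      if "b \<in> Basis" for b
    proof -
      note du = C2_on_has_derivative(2)[OF u2 D inD[OF p(1)] that]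
      from has_derivative_compose[OF aff du] show ?thesis
        unfolding frechet_derivative_scaleR[OF du] real_scaleR_def
        by (intro has_derivative_diff has_derivative_mult_right
            C2_on_has_derivative(2)[OF v2 open_ball pb that])
    qed
  qed
  then have "s * laplacian v p - M * \<rho>\<^sup>2 * laplacian u (x0 + \<rho> *\<^sub>R p) \<le> 0"
    by (simp add: laplacian_def sum_subtractf sum_distrib_left power2_eq_square mult.assoc)
  moreover have "laplacian v p = - (mu * v p)" "laplacian u (x0 + \<rho> *\<^sub>R p) = - (lam * ?U p)"
    using veq[OF pb] ueq[OF inD[OF p(1)]] by simp_all
  ultimately have "M * \<rho>\<^sup>2 * lam * ?U p \<le> mu * (s * v p)" by (simp add: algebra_simps)
  then have "(lam * \<rho>\<^sup>2) * (M * ?U p) \<le> mu * (M * ?U p)" by (simp add: vp algebra_simps)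
  then show ?thesis using M Up by (simp add: mult_le_cancel_right mult_less_0_iff zero_less_mult_iff)
qed

section \<open>Distance from the maximum point to the boundary\<close>

text \<open>Take the hyperplane separating \<open>D\<close> from a nearest boundary point
  \<open>z\<close>. With unit normal, \<open>c - n \<bullet> y\<close> is the distance of
  \<open>y\<close> to it, and Cauchy-Schwarz bounds this at \<open>x\<close> by
  \<open>dist x z\<close>.\<close>

lemma supporting_slab_at_nearest_frontier_point:
  fixes D :: "'a::euclidean_space set"
  assumes "bounded D" "convex D" "open D" "x \<in> D"
  obtains n c where "norm n = 1" "\<And>y. y \<in> closure D \<Longrightarrow> 0 \<le> c - n \<bullet> y"
    "c - n \<bullet> x \<le> infdist x (frontier D)"
proof -
  have "frontier D \<noteq> {}"
    using assms by (auto simp: frontier_eq_empty)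
  then obtain z where z: "z \<in> frontier D" "infdist x (frontier D) = dist x z"
    using infdist_attains_inf[of "frontier D" x] by auto
  then have "z \<notin> D" using assms(3) by (simp add: frontier_def interior_open)
  then obtain a b where ab: "a \<noteq> 0" "\<And>y. y \<in> D \<Longrightarrow> a \<bullet> y \<le> b" "b \<le> a \<bullet> z"
    using separating_hyperplane_sets[of D "{z}"] assms by auto
  define n where "n = a /\<^sub>R norm a"
  have n1: "norm n = 1" using ab(1) by (simp add: n_def)
  have "D \<subseteq> {y. n \<bullet> y \<le> n \<bullet> z}"
    using ab by (force simp: n_def divide_simps)
  then have "closure D \<subseteq> {y. n \<bullet> y \<le> n \<bullet> z}"
    by (rule closure_minimal) (rule closed_halfspace_le)
  then have "0 \<le> n \<bullet> z - n \<bullet> y" if "y \<in> closure D" for y using that by auto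
  moreover have "n \<bullet> z - n \<bullet> x \<le> infdist x (frontier D)"
    using Cauchy_Schwarz_ineq2[of n "z - x"] n1 z(2)
    by (simp add: inner_diff_right dist_norm norm_minus_commute)
  ultimately show ?thesis using that[of n "n \<bullet> z"] n1 by blast
qed

text \<open>The barrier \<open>M * (1 - (t y)\<^sup>2)\<close> is 0 on the hyperplane and
  \<open>M\<close> at distance \<open>a\<close> from it. The excess \<open>g\<close> of
  \<open>u\<close> over it is positive at \<open>x\<close>, but nonpositive on the boundary of
  \<open>D\<close> and on the face \<open>t = 0\<close>. So \<open>g\<close> has an interior maximum
  \<open>p\<close>, where the Laplacian of \<open>g\<close>, namely
  \<open>laplacian u p + 2 * M / a\<^sup>2\<close>, is nonpositive.\<close>

lemma eigenvalue_ge_of_max_near_hyperplane: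
  fixes u :: "'a::euclidean_space \<Rightarrow> real"
  assumes "bounded D" and D: "open D" and u: "dirichlet_eigenfunction D lam u"
    and pos: "\<And>x. x \<in> D \<Longrightarrow> 0 < u x"
    and x: "x \<in> D" and umax: "\<And>y. y \<in> D \<Longrightarrow> u y \<le> u x"
    and n: "norm n = 1" and slab: "\<And>y. y \<in> closure D \<Longrightarrow> 0 \<le> c - n \<bullet> y"
    and a: "c - n \<bullet> x < a"
  shows "2 \<le> lam * a\<^sup>2"
proof -
  have a0: "0 < a" using slab[of x] a x closure_subset by fastforce
  have u2: "C2_on D u" and ueq: "\<And>x. x \<in> D \<Longrightarrow> - laplacian u x = lam * u x"
    and u0: "\<And>x. x \<in> frontier D \<Longrightarrow> u x = 0" and uc: "continuous_on (closure D) u"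
    using u by (auto simp: dirichlet_eigenfunction_def)
  define M where "M = u x"
  have M: "0 < M" using pos x by (simp add: M_def)
  define t where "t y = 1 - (c - n \<bullet> y) / a" for y
  define g where "g y = u y - M * (1 - (t y)\<^sup>2)" for y
  have t_cont: "continuous_on T t" for T
    unfolding t_def by (intro continuous_intros) (use a0 in auto)
  have t0: "0 \<le> t y \<longleftrightarrow> c - n \<bullet> y \<le> a" "0 < t y \<longleftrightarrow> c - n \<bullet> y < a" for y
    using a0 by (simp_all add: t_def field_simps)
  have t1: "t y \<le> 1" if "y \<in> closure D" for y using slab[OF that] a0 by (simp add: t_def)
  let ?K = "closure D \<inter> {y. 0 \<le> t y}"
  have "closed {y. 0 \<le> t y}" using t_cont by (intro closed_Collect_le) auto
  then have "compact ?K"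
    using \<open>bounded D\<close> by (intro compact_Int_closed) auto
  moreover have "x \<in> ?K" using x a closure_subset t0 by auto
  moreover have "continuous_on ?K g"
    unfolding g_def by (intro continuous_intros t_cont continuous_on_subset[OF uc]) auto
  ultimately obtain p where p: "p \<in> closure D" "0 \<le> t p" and pmax: "\<And>y. y \<in> ?K \<Longrightarrow> g y \<le> g p"
    using continuous_attains_sup[of ?K g] by auto
  \<comment> \<open>Since \<open>u x = M\<close>, the value is \<open>M * (t x)\<^sup>2\<close>;
    here the strict inequality for \<open>a\<close> enters.\<close>
  have "0 < g x"
    using t0(2)[of x] a M by (simp add: g_def M_def[symmetric] algebra_simps)
  then have gp: "0 < g p" using pmax[OF \<open>x \<in> ?K\<close>] by simp
  have pD: "p \<in> D"
  proof (rule ccontr)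
    assume "p \<notin> D"
    then have "u p = 0" using p(1) D by (intro u0) (simp add: frontier_def interior_open)
    moreover have "(t p)\<^sup>2 \<le> 1" using p t1[of p] by (simp add: power_le_one)
    ultimately show False using gp M by (simp add: g_def mult_less_0_iff)
  qed
  \<comment> \<open>On the inner face the barrier equals the global maximum \<open>M\<close>, so
    \<open>g\<close> cannot be positive there.\<close>
  have "t p \<noteq> 0" using gp umax[OF pD] by (auto simp: g_def M_def)
  then have tp: "0 < t p" using p(2) by simp
  let ?S = "D \<inter> {y. 0 < t y}"
  have "open ?S" using D t_cont by (intro open_Int open_Collect_less) auto
  have dt: "(t has_derivative (\<lambda>h. (n \<bullet> h) / a)) (at y)" for y
    unfolding t_def using a0 by (auto intro!: derivative_eq_intros)
  have "(\<Sum>b\<in>Basis. frechet_derivative (\<lambda>y. frechet_derivative u (at y) b) (at p) b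
      + 2 * M * ((n \<bullet> b) / a) * ((n \<bullet> b) / a)) \<le> 0"
  proof (rule sum_second_derivatives_nonpos_at_max[OF \<open>open ?S\<close>, of p g
        "\<lambda>y h. frechet_derivative u (at y) h + 2 * M * ((n \<bullet> h) / a) * t y"
        "\<lambda>b h. frechet_derivative (\<lambda>y. frechet_derivative u (at y) b) (at p) h
      + 2 * M * ((n \<bullet> b) / a) * ((n \<bullet> h) / a)"])
    show "p \<in> ?S" using pD tp by simp
    show "g y \<le> g p" if "y \<in> ?S" for y
      using that closure_subset by (intro pmax) fastforce
    show "(g has_derivative (\<lambda>h. frechet_derivative u (at y) h + 2 * M * ((n \<bullet> h) / a) * t y)) (at y)"
      if "y \<in> ?S" for y
      unfolding g_def using that
      by (auto intro!: derivative_eq_intros C2_on_has_derivative(1)[OF u2 D] dt)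
    show "((\<lambda>y. frechet_derivative u (at y) b + 2 * M * ((n \<bullet> b) / a) * t y) has_derivative
       (\<lambda>h. frechet_derivative (\<lambda>y. frechet_derivative u (at y) b) (at p) h
      + 2 * M * ((n \<bullet> b) / a) * ((n \<bullet> h) / a))) (at p)" if "b \<in> Basis" for b
      by (intro has_derivative_add has_derivative_mult_right dt C2_on_has_derivative(2)[OF u2 D pD that])
  qed
  moreover have "(\<Sum>b\<in>Basis. 2 * M * ((n \<bullet> b) / a) * ((n \<bullet> b) / a)) = 2 * M / a\<^sup>2"
  proof -
    have "(\<Sum>b\<in>Basis. (n \<bullet> b) * (n \<bullet> b)) = 1"
      using n by (simp add: euclidean_inner[of n n, symmetric] norm_eq_1)
    then show ?thesis
      by (simp add: sum_distrib_left[symmetric] sum_divide_distrib[symmetric] power2_eq_square mult.assoc)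
  qed
  ultimately have "2 * M / a\<^sup>2 \<le> lam * u p"
    using ueq[OF pD] by (simp add: laplacian_def sum.distrib)
  moreover have "0 < 2 * M / a\<^sup>2" using M a0 by simp
  moreover have "0 < u p" using pos pD by blast
  \<comment> \<open>The sign of \<open>lam\<close> is not a hypothesis; it is required before
    \<open>u p\<close> may be replaced by \<open>M\<close>.\<close>
  ultimately have "0 < lam" by (metis less_le_trans zero_less_mult_pos2)
  then have "lam * u p \<le> lam * M" using umax[OF pD] by (simp add: M_def)
  with \<open>2 * M / a\<^sup>2 \<le> lam * u p\<close> have "2 * M / a\<^sup>2 \<le> lam * M" by linarith
  then have "2 * M \<le> lam * M * a\<^sup>2" using a0 by (simp add: divide_le_eq)
  then show ?thesis using M by (simp add: mult.commute mult.left_commute)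
qed

text \<open>The slab must be strictly wider than the distance, so its width \<open>a\<close>
  decreases to the distance in the limit.\<close>

lemma eigenvalue_times_dist_squared_ge:
  fixes u :: "'a::euclidean_space \<Rightarrow> real"
  assumes "bounded D" "convex D" "open D" "dirichlet_eigenfunction D lam u"
    and "\<And>x. x \<in> D \<Longrightarrow> 0 < u x" "x \<in> D" "\<And>y. y \<in> D \<Longrightarrow> u y \<le> u x"
  shows "2 \<le> lam * (infdist x (frontier D))\<^sup>2"
proof -
  obtain n c where n: "norm n = 1" "\<And>y. y \<in> closure D \<Longrightarrow> 0 \<le> c - n \<bullet> y"
    and c: "c - n \<bullet> x \<le> infdist x (frontier D)"
    using supporting_slab_at_nearest_frontier_point assms(1-3,6) by blast
  let ?r = "infdist x (frontier D)"
  have "2 \<le> lam * a\<^sup>2" if "?r < a" for a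
    using eigenvalue_ge_of_max_near_hyperplane[OF assms(1,3,4,5,6,7) n, of a] c that by auto
  moreover have "((\<lambda>a. lam * a\<^sup>2) \<longlongrightarrow> lam * ?r\<^sup>2) (at_right ?r)"
    by (intro tendsto_intros)
  ultimately show ?thesis
    by (intro tendsto_lowerbound[of _ _ "at_right ?r"])
      (auto intro: eventually_at_right_less[THEN eventually_mono])
qed

section \<open>Passage from closed balls to the inradius\<close>

text \<open>An open ball in \<open>D\<close> contains the concentric closed balls of smaller radius;
  letting these radii grow to \<open>r\<close> and then taking the supremum gives the bound. Any
  single ball in \<open>D\<close> already forces \<open>0 < mu\<close>.\<close>

lemma eigenvalue_times_inrad_squared_le:
  fixes D :: "'a::euclidean_space set"
  assumes D: "open D" "D \<noteq> {}" and lam: "0 < lam"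
    and u: "dirichlet_eigenfunction D lam u" "\<And>x. x \<in> D \<Longrightarrow> 0 < u x"
    and v: "dirichlet_eigenfunction (ball 0 1 :: 'a set) mu v"
  shows "0 < mu" "inrad D \<le> sqrt (mu / lam)"
proof -
  have le: "r \<le> sqrt (mu / lam)" if r: "0 < r" "ball x r \<subseteq> D" for r x
  proof (rule dense_le_bounded[OF r(1)])
    fix \<rho> assume \<rho>: "0 < \<rho>" "\<rho> < r"
    then have "cball x \<rho> \<subseteq> D" using r(2) by (auto simp: subset_iff)
    then have "lam * \<rho>\<^sup>2 \<le> mu"
      using eigenvalue_le_of_positive_eigenfunction[OF D(1) u v \<rho>(1)] by blast
    then show "\<rho> \<le> sqrt (mu / lam)"
      using lam by (intro real_le_rsqrt) (simp add: field_simps)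
  qed
  obtain x r where r: "0 < r" "ball x r \<subseteq> D"
    using D open_contains_ball by blast
  then have "0 < sqrt (mu / lam)" using le[of r x] by linarith
  then show "0 < mu" using lam by (simp add: zero_less_divide_iff)
  show "inrad D \<le> sqrt (mu / lam)"
    unfolding inrad_def using r le by (intro cSup_least) auto
qed

section \<open>Numerical bounds for the constant\<close>

text \<open>The Lagrange remainder has the sign of \<open>x ^ n\<close>: nonnegative for even
  \<open>n\<close>, nonpositive for odd \<open>n\<close> and \<open>x \<le> 0\<close>.\<close>

lemma exp_ge_Taylor_even:
  fixes x :: real
  assumes "even n"
  shows "(\<Sum>m<n. x ^ m / fact m) \<le> exp x"
proof -
  obtain t where "exp x = (\<Sum>m<n. x ^ m / fact m) + exp t / fact n * x ^ n"
    using Maclaurin_exp_le[of x n] by blast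
  moreover have "0 \<le> exp t / fact n * x ^ n"
    using assms by (simp add: zero_le_even_power)
  ultimately show ?thesis by linarith
qed

lemma exp_le_Taylor_odd:
  fixes x :: real
  assumes "odd n" "x \<le> 0"
  shows "exp x \<le> (\<Sum>m<n. x ^ m / fact m)"
proof -
  obtain t where "exp x = (\<Sum>m<n. x ^ m / fact m) + exp t / fact n * x ^ n"
    using Maclaurin_exp_le[of x n] by blast
  moreover have "exp t / fact n * x ^ n \<le> 0"
    using assms by (intro mult_nonneg_nonpos) (auto simp: power_le_zero_eq odd_pos)
  ultimately show ?thesis by linarith
qed

lemma exp_minus_bounds:
  fixes y :: real
  assumes "0 \<le> y"
  shows "1 - y + y\<^sup>2 / 2 - y ^ 3 / 6 \<le> exp (- y)" "exp (- y) \<le> 1 - y + y\<^sup>2 / 2"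
proof -
  have "even (4 :: nat)" "odd (3 :: nat)" by simp_all
  note exp_ge_Taylor_even[OF this(1), of "- y"] exp_le_Taylor_odd[OF this(2), of "- y"]
  then show "1 - y + y\<^sup>2 / 2 - y ^ 3 / 6 \<le> exp (- y)" "exp (- y) \<le> 1 - y + y\<^sup>2 / 2"
    using assms by (simp_all add: eval_nat_numeral)
qed

lemma exp_le_quadratic:
  fixes x :: real
  assumes "\<bar>x\<bar> \<le> 1"
  shows "exp x \<le> 1 + x + x\<^sup>2"
proof (cases "0 \<le> x")
  case True
  then show ?thesis using assms by (intro exp_bound) auto
next
  case False
  then have "exp x \<le> 1 + x + x\<^sup>2 / 2" using exp_minus_bounds(2)[of "- x"] by simp
  then show ?thesis by (smt (verit) field_sum_of_halves zero_le_power2)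
qed

section \<open>The Gaussian distribution function at -1\<close>

text \<open>Turns a pointwise bound \<open>p\<close> of the density, with antiderivative
  \<open>P\<close>, into a bound of the mass of \<open>{-1..1}\<close> by the fundamental theorem of
  calculus.\<close>

lemma density_normal_interval_bounds:
  fixes p P :: "real \<Rightarrow> real"
  assumes "\<And>x. \<bar>x\<bar> \<le> 1 \<Longrightarrow> (P has_real_derivative p x) (at x)"
    and "\<And>x. \<bar>x\<bar> \<le> 1 \<Longrightarrow> 0 \<le> p x" and "p \<in> borel_measurable borel"
    and "0 < \<sigma>"
  shows "(\<And>x. \<bar>x\<bar> \<le> 1 \<Longrightarrow> p x \<le> normal_density 0 \<sigma> x) \<Longrightarrow>
           P 1 - P (- 1) \<le> measure (density lborel (normal_density 0 \<sigma>)) {-1..1}"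
    and "(\<And>x. \<bar>x\<bar> \<le> 1 \<Longrightarrow> normal_density 0 \<sigma> x \<le> p x) \<Longrightarrow>
           measure (density lborel (normal_density 0 \<sigma>)) {-1..1} \<le> P 1 - P (- 1)"
proof -
  let ?N = "density lborel (normal_density 0 \<sigma>)"
  interpret prob_space ?N using assms(4) by (rule prob_space_normal_density)
  have I: "(\<integral>\<^sup>+x. ennreal (p x) * indicator {-1..1} x \<partial>lborel) = ennreal (P 1 - P (- 1))"
    by (rule nn_integral_FTC_Icc) (use assms in \<open>auto intro: DERIV_subset\<close>)
  have P: "0 \<le> P 1 - P (- 1)"
    using DERIV_nonneg_imp_nondecreasing[of "-1" 1 P] assms(1,2) by (fastforce simp: abs_le_iff)
  have E: "ennreal (measure ?N {-1..1}) = (\<integral>\<^sup>+x. ennreal (normal_density 0 \<sigma> x) * indicator {-1..1} x \<partial>lborel)"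
    by (simp add: emeasure_eq_measure[symmetric] emeasure_density)
  show "P 1 - P (- 1) \<le> measure ?N {-1..1}" if "\<And>x. \<bar>x\<bar> \<le> 1 \<Longrightarrow> p x \<le> normal_density 0 \<sigma> x"
  proof -
    have "ennreal (P 1 - P (- 1)) \<le> ennreal (measure ?N {-1..1})"
      unfolding I[symmetric] E
      by (rule nn_integral_mono) (use that in \<open>auto simp: indicator_def intro!: ennreal_leI\<close>)
    then show ?thesis by (simp add: ennreal_le_iff)
  qed
  show "measure ?N {-1..1} \<le> P 1 - P (- 1)" if "\<And>x. \<bar>x\<bar> \<le> 1 \<Longrightarrow> normal_density 0 \<sigma> x \<le> p x"
  proof -
    have "ennreal (measure ?N {-1..1}) \<le> ennreal (P 1 - P (- 1))"
      unfolding I[symmetric] E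
      by (rule nn_integral_mono) (use that in \<open>auto simp: indicator_def intro!: ennreal_leI\<close>)
    then show ?thesis using P by (simp add: ennreal_le_iff)
  qed
qed

text \<open>By reflection both tails have equal mass, and the endpoints carry none.\<close>

lemma cdf_normal_minus_one:
  assumes "0 < \<sigma>"
  shows "2 * cdf (density lborel (normal_density 0 \<sigma>)) (- 1)
    = 1 - measure (density lborel (normal_density 0 \<sigma>)) {-1..1}"
proof -
  let ?N = "density lborel (normal_density 0 \<sigma>)"
  interpret prob_space ?N using assms by (rule prob_space_normal_density)
  have "emeasure ?N {..-1} = (\<integral>\<^sup>+x. ennreal (normal_density 0 \<sigma> x) * indicator {..-1} x \<partial>lborel)"
    by (simp add: emeasure_density)
  also have "\<dots> = (\<integral>\<^sup>+x. ennreal (normal_density 0 \<sigma> (- x)) * indicator {..-1} (- x) \<partial>lborel)"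
    by (subst nn_integral_real_affine[where c="-1" and t=0]) simp_all
  also have "\<dots> = (\<integral>\<^sup>+x. ennreal (normal_density 0 \<sigma> x) * indicator {1..} x \<partial>lborel)"
    by (rule nn_integral_cong) (auto simp: normal_density_def indicator_def)
  also have "\<dots> = emeasure ?N {1..}"
    by (simp add: emeasure_density)
  finally have sym: "measure ?N {..-1} = measure ?N {1..}"
    by (simp add: measure_def)
  have null: "measure ?N {x} = 0" for x
  proof -
    have "emeasure ?N {x} = 0"
      by (simp add: emeasure_density nn_integral_0_iff_AE AE_lborel_singleton[THEN AE_mp])
    then show ?thesis by (simp add: measure_def)
  qed
  have "{-1..1} = {-1<..<1} \<union> ({-1} \<union> {1 :: real})" by auto
  then have "measure ?N {-1..1} = measure ?N {-1<..<1}"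
    using null by (subst \<open>{-1..1} = _\<close>, subst finite_measure_Union) 
      (auto simp: finite_measure_Union[of "{-1}" "{1}", simplified])
  moreover have "measure ?N UNIV = measure ?N {..-1} + (measure ?N {-1<..<1} + measure ?N {1..})"
  proof -
    have "UNIV = {..-1} \<union> ({-1<..<1} \<union> {1 :: real..})" by auto
    then show ?thesis
      by (subst \<open>UNIV = _\<close>, subst finite_measure_Union; (subst finite_measure_Union)?) auto
  qed
  moreover have "measure ?N UNIV = 1" using prob_space by simp
  ultimately show ?thesis using sym by (simp add: cdf_def2)
qed

lemma gauss2_cdf_bounds:
  "2395 / 10000 \<le> gauss2_cdf (- 1)"
  "gauss2_cdf (- 1) \<le> 239756 / 1000000"
proof -
  let ?m = "measure (density lborel (normal_density 0 (sqrt 2))) {-1..1}"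
  define k where "k = 1 / sqrt (4 * pi)"
  have k: "0 < k" by (simp add: k_def)
  have nd: "normal_density 0 (sqrt 2) x = k * exp (- (x\<^sup>2 / 4))" for x
    by (simp add: normal_density_def k_def)
  \<comment> \<open>The upper bound is the sharp one: it yields the upper bound of
    \<open>gauss2_cdf (- 1)\<close>, on which the tight estimate near the minimiser depends.\<close>
  have "sqrt (4 * pi) \<le> 354491 / 100000" "3544 / 1000 \<le> sqrt (4 * pi)"
    by (rule real_le_lsqrt real_le_rsqrt; use pi_approx in \<open>simp add: power2_eq_square\<close>)+
  then have k1: "1 / (354491 / 100000) \<le> k" and k2: "k \<le> 1 / (3544 / 1000)"
    unfolding k_def by (intro divide_left_mono; simp)+
  have q: "2 * gauss2_cdf (- 1) = 1 - ?m"
    unfolding gauss2_cdf_def by (rule cdf_normal_minus_one) simp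
  have small: "x\<^sup>2 \<le> 1" "0 \<le> x\<^sup>2" if "\<bar>x\<bar> \<le> 1" for x :: real
    using that by (simp_all add: abs_square_le_1)
  \<comment> \<open>The cubic Taylor polynomial of \<open>exp (- y)\<close> at
    \<open>y = x\<^sup>2 / 4\<close>, a lower bound of the density; \<open>?P\<close> is its
    antiderivative. Below, the quadratic polynomial serves as upper bound.\<close>
  let ?p = "\<lambda>x :: real. k * (1 - x\<^sup>2 / 4 + x ^ 4 / 32 - x ^ 6 / 384)"
  let ?P = "\<lambda>x :: real. k * (x - x ^ 3 / 12 + x ^ 5 / 160 - x ^ 7 / 2688)"
  have "?P 1 - ?P (- 1) \<le> ?m"
  proof (rule density_normal_interval_bounds(1))
    show "(?P has_real_derivative ?p x) (at x)" for x
      by (auto intro!: derivative_eq_intros simp: field_simps)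
    show "0 \<le> ?p x" if "\<bar>x\<bar> \<le> 1" for x
    proof -
      have "x ^ 6 \<le> 1" "0 \<le> x ^ 4"
        using small[OF that] power_le_one[of "x\<^sup>2" 3] by (simp_all add: power_mult[symmetric])
      then have "0 \<le> 1 - x\<^sup>2 / 4 + x ^ 4 / 32 - x ^ 6 / 384"
        using small[OF that] by linarith
      then show ?thesis using k by simp
    qed
    show "?p x \<le> normal_density 0 (sqrt 2) x" for x
      using exp_minus_bounds(1)[of "x\<^sup>2 / 4"] k unfolding nd
      by (intro mult_left_mono) (simp_all add: power_divide power_mult[symmetric])
  qed auto
  then show "gauss2_cdf (- 1) \<le> 239756 / 1000000"
    using q k1 by simp
  let ?r = "\<lambda>x :: real. k * (1 - x\<^sup>2 / 4 + x ^ 4 / 32)"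
  let ?R = "\<lambda>x :: real. k * (x - x ^ 3 / 12 + x ^ 5 / 160)"
  have "?m \<le> ?R 1 - ?R (- 1)"
  proof (rule density_normal_interval_bounds(2))
    show "(?R has_real_derivative ?r x) (at x)" for x
      by (auto intro!: derivative_eq_intros simp: field_simps)
    show "0 \<le> ?r x" if "\<bar>x\<bar> \<le> 1" for x
    proof -
      have "0 \<le> x ^ 4" by simp
      then have "0 \<le> 1 - x\<^sup>2 / 4 + x ^ 4 / 32"
        using small[OF that] by linarith
      then show ?thesis using k by simp
    qed
    show "normal_density 0 (sqrt 2) x \<le> ?r x" for x
      using exp_minus_bounds(2)[of "x\<^sup>2 / 4"] k unfolding nd
      by (intro mult_left_mono) (simp_all add: power_divide power_mult[symmetric])
  qed auto
  then show "2395 / 10000 \<le> gauss2_cdf (- 1)"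
    using q k2 by simp
qed

section \<open>The objective and its minimum\<close>

lemma exp_five_quarters_bounds:
  "286502 / 1000000 \<le> exp (- 5 / 4 :: real)"
  "exp (- 5 / 4 :: real) \<le> 28653 / 100000"
proof -
  have "even (10 :: nat)" "odd (9 :: nat)" by simp_all
  note exp_ge_Taylor_even[OF this(1), of "- 5 / 4"] exp_le_Taylor_odd[OF this(2), of "- 5 / 4"]
  then show "286502 / 1000000 \<le> exp (- 5 / 4 :: real)" "exp (- 5 / 4 :: real) \<le> 28653 / 100000"
    by (simp_all add: lessThan_nat_numeral lessThan_Suc fact_numeral power_divide)
qed

lemma exp_le_at_nine_quarters: "exp (- (834 / 10000 * 9 / 4) :: real) \<le> 828906 / 1000000"
proof -
  have "odd (7 :: nat)" by simp
  from exp_le_Taylor_odd[OF this, of "- (834 / 10000 * 9 / 4)"] show ?thesis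
    by (simp add: lessThan_nat_numeral lessThan_Suc fact_numeral power_divide)
qed

definition theta_objective :: "real \<Rightarrow> real" where
  "theta_objective \<kappa> = 1 / \<kappa> * ln (1 - gauss2_cdf (-1) * (1 - exp (1 - \<kappa>)))"

lemma theta_objective_arg_lower:
  assumes "1 \<le> \<kappa>"
  shows "760244 / 1000000 + 239756 / 1000000 * exp (1 - \<kappa>)
           \<le> 1 - gauss2_cdf (-1) * (1 - exp (1 - \<kappa>))"
    and "760244 / 1000000 \<le> 1 - gauss2_cdf (-1) * (1 - exp (1 - \<kappa>))"
    and "0 < 1 - gauss2_cdf (-1) * (1 - exp (1 - \<kappa>))"
proof -
  have "0 \<le> 1 - exp (1 - \<kappa>)" using assms by simp
  from mult_right_mono[OF gauss2_cdf_bounds(2) this]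
  have "gauss2_cdf (-1) * (1 - exp (1 - \<kappa>)) \<le> 239756 / 1000000 - 239756 / 1000000 * exp (1 - \<kappa>)"
    by (simp add: right_diff_distrib)
  then show 1: "760244 / 1000000 + 239756 / 1000000 * exp (1 - \<kappa>)
           \<le> 1 - gauss2_cdf (-1) * (1 - exp (1 - \<kappa>))"
    by linarith
  have "0 \<le> 239756 / 1000000 * exp (1 - \<kappa>)" by simp
  with 1 show "760244 / 1000000 \<le> 1 - gauss2_cdf (-1) * (1 - exp (1 - \<kappa>))"
    by linarith
  then show "0 < 1 - gauss2_cdf (-1) * (1 - exp (1 - \<kappa>))" by linarith
qed

lemma less_theta_objective_iff:
  assumes "1 < \<kappa>"
  shows "- c < theta_objective \<kappa> \<longleftrightarrow> exp (- (c * \<kappa>)) < 1 - gauss2_cdf (-1) * (1 - exp (1 - \<kappa>))"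
    (is "?A < ?B \<longleftrightarrow> ?C < ?D")
proof -
  have "?A < ?B \<longleftrightarrow> - (c * \<kappa>) < ln ?D"
    using assms by (simp add: theta_objective_def field_simps)
  also have "\<dots> \<longleftrightarrow> ?C < ?D"
    using theta_objective_arg_lower(3)[of \<kappa>] assms by (metis exp_less_cancel_iff exp_ln less_imp_le)
  finally show ?thesis .
qed

lemma theta_objective_gt_of_large:
  assumes "15 / 4 \<le> \<kappa>"
  shows "- (832 / 10000) < theta_objective \<kappa>"
proof -
  have "exp (- (832 / 10000 * \<kappa>)) \<le> exp (- (3 / 10))" using assms by simp
  also have "\<dots> \<le> 745 / 1000" using exp_minus_bounds(2)[of "3 / 10"] by (simp add: power2_eq_square)
  also have "\<dots> < 760244 / 1000000" by simp
  also have "\<dots> \<le> 1 - gauss2_cdf (-1) * (1 - exp (1 - \<kappa>))"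
    using assms by (intro theta_objective_arg_lower(2)) simp
  finally show ?thesis using assms by (subst less_theta_objective_iff) auto
qed

lemma theta_objective_nine_quarters: "theta_objective (9 / 4) < - (832 / 10000)"
proof -
  have "1 - gauss2_cdf (-1) * (1 - exp (1 - 9 / 4)) \<le> 1 - 2395 / 10000 * (1 - 28653 / 100000)"
    using mult_mono[OF gauss2_cdf_bounds(1), of "1 - 28653 / 100000" "1 - exp (1 - 9 / 4)"]
      exp_five_quarters_bounds gauss2_cdf_bounds by simp
  \<comment> \<open>\<open>1872 / 10000\<close> is \<open>832 / 10000 * 9 / 4\<close>.\<close>
  also have "\<dots> < 1 - 1872 / 10000 + (1872 / 10000)\<^sup>2 / 2 - (1872 / 10000) ^ 3 / (6 :: real)"
    by (simp add: eval_nat_numeral)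
  also have "\<dots> \<le> exp (- (1872 / 10000))" by (rule exp_minus_bounds) simp
  finally have "ln (1 - gauss2_cdf (-1) * (1 - exp (1 - 9 / 4))) < - (1872 / 10000)"
    using theta_objective_arg_lower(3)[of "9 / 4"] by (subst exp_less_cancel_iff[symmetric]) simp
  then show ?thesis by (simp add: theta_objective_def)
qed

lemma theta_objective_gt:
  assumes "1 < \<kappa>"
  shows "- (834 / 10000) < theta_objective \<kappa>"
proof (cases "15 / 4 \<le> \<kappa>")
  case True
  then show ?thesis using theta_objective_gt_of_large[of \<kappa>] by linarith
next
  case False
  text \<open>Near the minimiser \<open>9 / 4\<close> the first-order terms of the two exponentials nearly cancel, so
    quadratic bounds suffice; the margin there is only about \<open>3 / 10\<^sup>5\<close>, which dictates the
    precision of all constants.\<close>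
  define s where "s = \<kappa> - 9 / 4"
  have s: "- (5 / 4) \<le> s" "s \<le> 3 / 2" using assms False by (auto simp: s_def)
  have lo: "1 - s + s\<^sup>2 / 4 \<le> exp (- s)"
  proof -
    have "even (4 :: nat)" by simp
    from exp_ge_Taylor_even[OF this, of "- s"]
    have "1 - s + s\<^sup>2 / 2 - s ^ 3 / 6 \<le> exp (- s)" by (simp add: eval_nat_numeral)
    \<comment> \<open>The cutoff \<open>15 / 4\<close> gives \<open>s \<le> 3 / 2\<close>, which
      lets half of the quadratic term absorb the cubic one.\<close>
    moreover have "0 \<le> s\<^sup>2 * (3 / 2 - s)" using s by (intro mult_nonneg_nonneg) auto
    then have "s ^ 3 / 6 \<le> s\<^sup>2 / 4" by (simp add: field_simps eval_nat_numeral)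
    ultimately show ?thesis by linarith
  qed
  have up: "exp (- (834 / 10000 * s)) \<le> 1 - 834 / 10000 * s + 695556 / 100000000 * s\<^sup>2"
    using exp_le_quadratic[of "- (834 / 10000 * s)"] s
    by (simp add: abs_le_iff power_mult_distrib power_divide)
  have "exp (- (834 / 10000 * \<kappa>)) = exp (- (834 / 10000 * 9 / 4)) * exp (- (834 / 10000 * s))"
    unfolding exp_add[symmetric] by (simp add: s_def field_simps)
  then have 1: "exp (- (834 / 10000 * \<kappa>))
      \<le> 828906 / 1000000 * (1 - 834 / 10000 * s + 695556 / 100000000 * s\<^sup>2)"
    using mult_mono[OF exp_le_at_nine_quarters up] by simp
  \<comment> \<open>Right minus left is a quadratic in \<open>s\<close> with constant term about
    \<open>2.9 / 10^5\<close> and linear coefficient about \<open>4.4 / 10^4\<close>. One hundredth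
    of \<open>(s + 22 / 1000)\<^sup>2\<close> takes up the linear term; what remains of the other
    two is positive.\<close>
  have 2: "828906 / 1000000 * (1 - 834 / 10000 * s + 695556 / 100000000 * s\<^sup>2)
      < 760244 / 1000000 + 239756 / 1000000 * (286502 / 1000000 * (1 - s + s\<^sup>2 / 4))"
  proof -
    have "0 \<le> (s + 22 / 1000)\<^sup>2" by simp
    then have "0 \<le> s\<^sup>2 + 44 / 1000 * s + 484 / 1000000"
      by (simp add: power2_sum power_divide)
    moreover have "0 \<le> s\<^sup>2" by simp
    ultimately show ?thesis
      unfolding right_diff_distrib distrib_left using s by linarith
  qed
  \<comment> \<open>The lower bound of \<open>exp (- s)\<close> is this square, so the lower bounds
    may be multiplied.\<close>
  have "0 \<le> (1 - s / 2)\<^sup>2" by simp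
  then have "0 \<le> 1 - s + s\<^sup>2 / 4" by (simp add: power2_eq_square field_simps)
  then have "286502 / 1000000 * (1 - s + s\<^sup>2 / 4) \<le> exp (- 5 / 4) * exp (- s)"
    by (intro mult_mono[OF exp_five_quarters_bounds(1) lo]) simp_all
  also have "exp (- 5 / 4) * exp (- s) = exp (1 - \<kappa>)"
    unfolding exp_add[symmetric] by (simp add: s_def)
  finally have 3: "286502 / 1000000 * (1 - s + s\<^sup>2 / 4) \<le> exp (1 - \<kappa>)" .
  have 4: "239756 / 1000000 * (286502 / 1000000 * (1 - s + s\<^sup>2 / 4))
      \<le> 239756 / 1000000 * exp (1 - \<kappa>)"
    using 3 by (rule mult_left_mono) simp
  have "760244 / 1000000 + 239756 / 1000000 * exp (1 - \<kappa>)
      \<le> 1 - gauss2_cdf (-1) * (1 - exp (1 - \<kappa>))"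
    using assms by (intro theta_objective_arg_lower(1)) simp
  then have "exp (- (834 / 10000 * \<kappa>)) < 1 - gauss2_cdf (-1) * (1 - exp (1 - \<kappa>))"
    using 1 2 4 by linarith
  then show ?thesis using assms by (subst less_theta_objective_iff)
qed

text \<open>Compactness gives a minimiser on \<open>{1..15 / 4}\<close>. It is not 1, where the
  objective is 0, and larger \<open>\<kappa>\<close> cannot beat the value at \<open>9 / 4\<close>;
  so the minimum over \<open>{1<..}\<close> is attained and \<open>LEAST\<close> denotes it.\<close>

lemma theta_bounds: "832 / 10000 < theta" "theta < 834 / 10000"
proof -
  have "continuous_on {1..15 / 4} theta_objective"
    unfolding theta_objective_def
    using theta_objective_arg_lower(3) by (intro continuous_intros) (force)+
  then obtain m where m: "m \<in> {1..15 / 4}" "\<And>\<kappa>. \<kappa> \<in> {1..15 / 4} \<Longrightarrow> theta_objective m \<le> theta_objective \<kappa>"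
    using continuous_attains_inf[of "{1..15 / 4}" theta_objective] by auto
  have m_neg: "theta_objective m < - (832 / 10000)"
    using m(2)[of "9 / 4"] theta_objective_nine_quarters by simp
  then have "m \<noteq> 1" by (auto simp: theta_objective_def)
  then have m1: "1 < m" using m(1) by simp
  have "theta_objective m \<le> theta_objective \<kappa>" if "1 < \<kappa>" for \<kappa>
    using m(2)[of \<kappa>] theta_objective_gt_of_large[of \<kappa>] m_neg that by fastforce
  then have "(LEAST y. y \<in> theta_objective ` {1<..}) = theta_objective m"
    using m1 by (intro Least_equality) auto
  then have "theta = - theta_objective m"
    by (simp add: theta_def theta_objective_def[abs_def])
  then show "832 / 10000 < theta" "theta < 834 / 10000"
    using m_neg theta_objective_gt[OF m1] by linarith+
qed

section \<open>The distance estimate\<close>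

theorem corollary3p4:
  fixes D :: "(real ^ 'd) set"
    and u :: "real ^ 'd \<Rightarrow> real"
    and xmax :: "real ^ 'd"
    and lamD lamB :: real
  assumes "bounded D" and "convex D" and "open D"
    and "principal_dirichlet_eigenvalue D lamD"
    and "dirichlet_eigenfunction D lamD u" and "\<forall>x\<in>D. u x > 0"
    and "xmax \<in> D" and "\<forall>x\<in>D. u x \<le> u xmax"
    and "principal_dirichlet_eigenvalue (ball (0 :: real ^ 'd) 1) lamB"
  shows "\<bar>theta - 0.0833\<bar> < 0.0001 \<and>
         infdist xmax (frontier D) \<ge> sqrt (theta / lamB) * inrad D"
proof
  show "\<bar>theta - 0.0833\<bar> < 0.0001"
    unfolding abs_less_iff using theta_bounds by simp
next
  let ?r = "infdist xmax (frontier D)"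
  have r: "2 \<le> lamD * ?r\<^sup>2"
    using eigenvalue_times_dist_squared_ge[of D lamD u xmax] assms by blast
  \<comment> \<open>Positivity of the eigenvalue comes from the distance bound itself.\<close>
  then have lam: "0 < lamD"
    by (smt (verit) mult_nonpos_nonneg zero_le_power2)
  obtain v where "dirichlet_eigenfunction (ball (0 :: real ^ 'd) 1) lamB v"
    using assms by (auto simp: principal_dirichlet_eigenvalue_def dirichlet_eigenvalue_def)
  then have lamB: "0 < lamB" and inrad: "inrad D \<le> sqrt (lamB / lamD)"
    using eigenvalue_times_inrad_squared_le[of D lamD u lamB v] assms lam by blast+
  have "sqrt (theta / lamB) * inrad D \<le> sqrt (theta / lamB) * sqrt (lamB / lamD)"
    using inrad theta_bounds lamB by (intro mult_left_mono) simp_all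
  also have "\<dots> = sqrt (theta / lamD)"
    using lamB by (simp add: real_sqrt_mult[symmetric])
  also have "\<dots> \<le> ?r"
  proof (rule real_le_lsqrt)
    \<comment> \<open>By \<open>r\<close>, the squared distance is at least \<open>2 / lamD\<close>,
      and \<open>theta < 2\<close>.\<close>
    show "theta / lamD \<le> ?r\<^sup>2"
      using r theta_bounds lam by (simp add: divide_le_eq mult.commute)
  qed (simp add: infdist_nonneg)
  finally show "?r \<ge> sqrt (theta / lamB) * inrad D" .
qed

end
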